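(* Let $f:Y\to X$ be a normal (regular) covering of finite connected graphs with finite deck group $G$, defined by the surjective homomorphism $\phi:\pi_1(X)=F_n\to G$, where $n=\operatorname{rank}(\pi_1(X))\ge 2$. Then, with respect to the isomorphism of $G$-representations $H_1(Y;\mathbb{C})\cong\bigoplus_{V_i\in\operatorname{Irr}(G)}V_i^{(n-1)\dim(V_i)}\oplus\mathbb{C}_{triv}$, $$H_1^{\mathrm{prim}}(Y;\mathbb{C})\subseteq\bigoplus_{V_i\in\operatorname{Irr^{pr}}(\phi,G)}V_i^{(n-1)\cdot\dim(V_i)}\oplus\mathbb{C}_{triv}.$$
   Context: $F_n$ is the free group of rank $n$; an element of $F_n$ is primitive if it is part of a free basis. A normal cover $f:Y\to X$ with deck group $G$ corresponds to a surjection $\phi:\pi_1(X)=F_n\to G$ with kernel $\pi_1(Y)$. $G$ acts on $H_1(Y;\mathbb{C})$ through deck transformations, and there is an isomorphism of $G$-representations $H_1(Y;\mathbb{C})\cong\mathbb{C}[G]^{n-1}\oplus\mathbb{C}_{triv}$ (Gaschütz). Fix a basepoint $x_0\in X$ and a lift $\hat x_0\in Y$. For a loop $\gamma$ in $X$ at $x_0$, the preferred elevation $\hat\gamma$ is the lift at $\hat x_0$ of the smallest power $\gamma^k$ ($k\ge1$) that lifts to a closed loop in $Y$; the images of $\hat\gamma$ under deck transformations are the elevations of $\gamma$. The primitive homology $H_1^{\mathrm{prim}}(Y;\mathbb{C})\subseteq H_1(Y;\mathbb{C})$ is the $\mathbb{C}$-span of the homology classes of all elevations of loops representing primitive elements of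 $\pi_1(X)$; it is a $G$-subrepresentation. $\operatorname{Irr}(G)$ is the set of isomorphism classes of complex irreducible $G$-representations, $\mathbb{C}_{triv}$ is the trivial one. $\operatorname{Irr^{pr}}(\phi,G)\subseteq\operatorname{Irr}(G)$ is the set of irreducible representations $V$ such that $\phi(\gamma)(v)=v$ for some primitive $\gamma\in F_n$ and some nonzero $v\in V$. *)

theory Defs
  imports
    Complex_Main
    "HOL-Library.Function_Algebras"
    "HOL-Algebra.Group"
    "Graph_Theory.Graph_Theory"
begin

section \<open>Graphs, fundamental groups and coverings\<close>

text \<open>
  Graphs are graphs in the sense of Serre: every geometric edge is a pair of opposite arcs
  \<open>a\<close>, \<open>r a\<close>, exchanged by the fixed-point-free involution \<open>r\<close>. Loops and multiple edges are
  allowed. Paths are edge paths, i.e. the arc walks of Graph_Theory.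
\<close>

definition finite_connected_graph :: "('v, 'e) pre_digraph \<Rightarrow> ('e \<Rightarrow> 'e) \<Rightarrow> bool" where
  "finite_connected_graph X r \<longleftrightarrow> bidirected_digraph X r \<and> fin_digraph X \<and> connected X"

definition is_loop :: "('v, 'e) pre_digraph \<Rightarrow> 'v \<Rightarrow> 'e list \<Rightarrow> bool" where
  "is_loop X x p \<longleftrightarrow> pre_digraph.awalk X x p x"

definition spur_insertion ::
    "('v, 'e) pre_digraph \<Rightarrow> ('e \<Rightarrow> 'e) \<Rightarrow> 'v \<Rightarrow> ('e list \<times> 'e list) set" where
  "spur_insertion X r x =
     {(p, q). is_loop X x p \<and> is_loop X x q \<and>
        (\<exists>s t a. a \<in> arcs X \<and> p = s @ t \<and> q = s @ [a, r a] @ t)}"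

definition loop_homotopy ::
    "('v, 'e) pre_digraph \<Rightarrow> ('e \<Rightarrow> 'e) \<Rightarrow> 'v \<Rightarrow> ('e list \<times> 'e list) set" where
  "loop_homotopy X r x = (spur_insertion X r x \<union> (spur_insertion X r x)\<inverse>)\<^sup>*"

definition loop_class ::
    "('v, 'e) pre_digraph \<Rightarrow> ('e \<Rightarrow> 'e) \<Rightarrow> 'v \<Rightarrow> 'e list \<Rightarrow> 'e list set" where
  "loop_class X r x p = loop_homotopy X r x `` {p}"

definition fundamental_group ::
    "('v, 'e) pre_digraph \<Rightarrow> ('e \<Rightarrow> 'e) \<Rightarrow> 'v \<Rightarrow> 'e list set monoid" where
  "fundamental_group X r x =
     \<lparr>carrier = {p. is_loop X x p} // loop_homotopy X r x,
      monoid.mult = (\<lambda>A B. \<Union>p\<in>A. \<Union>q\<in>B. loop_class X r x (p @ q)),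
      monoid.one = loop_class X r x []\<rparr>"

text \<open>A letter \<open>(s, b)\<close> stands for \<open>b\<close> if \<open>s\<close> is true, and for the inverse of \<open>b\<close> otherwise.\<close>

fun reduced_word :: "(bool \<times> 'a) list \<Rightarrow> bool" where
  "reduced_word (x # y # w) \<longleftrightarrow> \<not> (snd x = snd y \<and> fst x \<noteq> fst y) \<and> reduced_word (y # w)"
| "reduced_word _ \<longleftrightarrow> True"

definition word_value :: "('a, 'm) monoid_scheme \<Rightarrow> (bool \<times> 'a) list \<Rightarrow> 'a" where
  "word_value F w =
     foldr (\<lambda>(s, b) z. (if s then b else m_inv F b) \<otimes>\<^bsub>F\<^esub> z) w \<one>\<^bsub>F\<^esub>"

definition free_basis :: "('a, 'm) monoid_scheme \<Rightarrow> 'a set \<Rightarrow> bool" where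
  "free_basis F B \<longleftrightarrow> B \<subseteq> carrier F \<and>
     bij_betw (word_value F) {w. snd ` set w \<subseteq> B \<and> reduced_word w} (carrier F)"

definition free_of_rank :: "nat \<Rightarrow> ('a, 'm) monoid_scheme \<Rightarrow> bool" where
  "free_of_rank n F \<longleftrightarrow> (\<exists>B. finite B \<and> card B = n \<and> free_basis F B)"

definition primitive :: "('a, 'm) monoid_scheme \<Rightarrow> 'a \<Rightarrow> bool" where
  "primitive F x \<longleftrightarrow> (\<exists>B. free_basis F B \<and> x \<in> B)"

text \<open>
  A covering is a graph morphism, given by a vertex map \<open>fv\<close> and an arc map \<open>fe\<close>, that is
  bijective on the star of every vertex. For connected \<open>X\<close> and nonempty \<open>Y\<close> it is
  automatically surjective.
\<close>

definition graph_covering ::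
    "('w, 'd) pre_digraph \<Rightarrow> ('d \<Rightarrow> 'd) \<Rightarrow> ('v, 'e) pre_digraph \<Rightarrow> ('e \<Rightarrow> 'e) \<Rightarrow>
     ('w \<Rightarrow> 'v) \<Rightarrow> ('d \<Rightarrow> 'e) \<Rightarrow> bool" where
  "graph_covering Y rY X rX fv fe \<longleftrightarrow>
     fv ` verts Y \<subseteq> verts X \<and> fe ` arcs Y \<subseteq> arcs X \<and>
     (\<forall>a\<in>arcs Y. tail X (fe a) = fv (tail Y a) \<and> head X (fe a) = fv (head Y a) \<and>
                fe (rY a) = rX (fe a)) \<and>
     (\<forall>y\<in>verts Y. bij_betw fe (out_arcs Y y) (out_arcs X (fv y)))"

text \<open>
  Automorphisms are required to be the identity outside the vertex and arc sets (\<open>permutes\<close>),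
  so that distinct elements of the carrier are distinct automorphisms.
\<close>

definition deck_group ::
    "('w, 'd) pre_digraph \<Rightarrow> ('d \<Rightarrow> 'd) \<Rightarrow> ('w \<Rightarrow> 'v) \<Rightarrow> ('d \<Rightarrow> 'e) \<Rightarrow>
     (('w \<Rightarrow> 'w) \<times> ('d \<Rightarrow> 'd)) monoid" where
  "deck_group Y rY fv fe =
     \<lparr>carrier = {(gv, ge). gv permutes verts Y \<and> ge permutes arcs Y \<and>
        (\<forall>a\<in>arcs Y. tail Y (ge a) = gv (tail Y a) \<and> head Y (ge a) = gv (head Y a) \<and>
                   ge (rY a) = rY (ge a)) \<and>
        (\<forall>y\<in>verts Y. fv (gv y) = fv y) \<and> (\<forall>a\<in>arcs Y. fe (ge a) = fe a)},
      monoid.mult = (\<lambda>g h. (fst g \<circ> fst h, snd g \<circ> snd h)),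
      monoid.one = (id, id)\<rparr>"

definition normal_covering ::
    "('w, 'd) pre_digraph \<Rightarrow> ('d \<Rightarrow> 'd) \<Rightarrow> ('v, 'e) pre_digraph \<Rightarrow> ('e \<Rightarrow> 'e) \<Rightarrow>
     ('w \<Rightarrow> 'v) \<Rightarrow> ('d \<Rightarrow> 'e) \<Rightarrow> bool" where
  "normal_covering Y rY X rX fv fe \<longleftrightarrow> graph_covering Y rY X rX fv fe \<and>
     (\<forall>y\<in>verts Y. \<forall>y'\<in>verts Y. fv y = fv y' \<longrightarrow>
        (\<exists>g\<in>carrier (deck_group Y rY fv fe). fst g y = y'))"

text \<open>
  The correspondence between \<open>\<phi>\<close> and the covering: \<open>\<phi> [p]\<close> is the deck transformation that
  moves the base lift \<open>y0\<close> to the endpoint of the lift of \<open>p\<close> at \<open>y0\<close>. The kernel of \<open>\<phi>\<close> then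
  consists of the classes of loops whose lift at \<open>y0\<close> is closed, i.e. it is \<open>\<pi>\<^sub>1(Y)\<close>.
\<close>

definition defines_covering ::
    "('w, 'd) pre_digraph \<Rightarrow> ('d \<Rightarrow> 'd) \<Rightarrow> ('v, 'e) pre_digraph \<Rightarrow> ('e \<Rightarrow> 'e) \<Rightarrow>
     ('w \<Rightarrow> 'v) \<Rightarrow> ('d \<Rightarrow> 'e) \<Rightarrow> 'w \<Rightarrow> ('e list set \<Rightarrow> ('w \<Rightarrow> 'w) \<times> ('d \<Rightarrow> 'd)) \<Rightarrow> bool" where
  "defines_covering Y rY X rX fv fe y0 \<phi> \<longleftrightarrow>
     \<phi> \<in> epi (fundamental_group X rX (fv y0)) (deck_group Y rY fv fe) \<and>
     (\<forall>q z. pre_digraph.awalk Y y0 q z \<and> is_loop X (fv y0) (map fe q) \<longrightarrow>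
        fst (\<phi> (loop_class X rX (fv y0) (map fe q))) y0 = z)"

definition preferred_elevation ::
    "('w, 'd) pre_digraph \<Rightarrow> ('d \<Rightarrow> 'e) \<Rightarrow> 'w \<Rightarrow> 'e list \<Rightarrow> 'd list \<Rightarrow> bool" where
  "preferred_elevation Y fe y0 p q \<longleftrightarrow>
     (\<exists>k\<ge>1. is_loop Y y0 q \<and> map fe q = concat (replicate k p) \<and>
        (\<forall>j\<ge>1. j < k \<longrightarrow>
           \<not> (\<exists>q'. is_loop Y y0 q' \<and> map fe q' = concat (replicate j p))))"


section \<open>Complex representations\<close>

text \<open>All vector spaces are subspaces of spaces of functions \<open>'i \<Rightarrow> complex\<close>.\<close>

definition cscale :: "complex \<Rightarrow> ('i \<Rightarrow> complex) \<Rightarrow> ('i \<Rightarrow> complex)" where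
  "cscale c f = (\<lambda>x. c * f x)"

interpretation cfun: vector_space "cscale :: complex \<Rightarrow> ('i \<Rightarrow> complex) \<Rightarrow> ('i \<Rightarrow> complex)"
  by unfold_locales (auto simp: cscale_def fun_eq_iff algebra_simps)

definition linear_map_on ::
    "('i \<Rightarrow> complex) set \<Rightarrow> (('i \<Rightarrow> complex) \<Rightarrow> ('k \<Rightarrow> complex)) \<Rightarrow> bool" where
  "linear_map_on V f \<longleftrightarrow> (\<forall>v\<in>V. \<forall>w\<in>V. f (v + w) = f v + f w) \<and>
     (\<forall>c. \<forall>v\<in>V. f (cscale c v) = cscale c (f v))"

text \<open>A representation is a pair of its underlying space and its action.\<close>

type_synonym ('g, 'i) rep =
  "('i \<Rightarrow> complex) set \<times> ('g \<Rightarrow> ('i \<Rightarrow> complex) \<Rightarrow> ('i \<Rightarrow> complex))"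

definition representation :: "('g, 'm) monoid_scheme \<Rightarrow> ('g, 'i) rep \<Rightarrow> bool" where
  "representation G R \<longleftrightarrow> cfun.subspace (fst R) \<and>
     (\<forall>g\<in>carrier G. linear_map_on (fst R) (snd R g) \<and> snd R g ` fst R \<subseteq> fst R) \<and>
     (\<forall>v\<in>fst R. snd R \<one>\<^bsub>G\<^esub> v = v) \<and>
     (\<forall>g\<in>carrier G. \<forall>h\<in>carrier G. \<forall>v\<in>fst R. snd R (g \<otimes>\<^bsub>G\<^esub> h) v = snd R g (snd R h v))"

definition irreducible_rep :: "('g, 'm) monoid_scheme \<Rightarrow> ('g, 'i) rep \<Rightarrow> bool" where
  "irreducible_rep G R \<longleftrightarrow> representation G R \<and> fst R \<noteq> {0} \<and>
     (\<forall>W. cfun.subspace W \<and> W \<subseteq> fst R \<and> (\<forall>g\<in>carrier G. snd R g ` W \<subseteq> W) \<longrightarrow>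
        W = {0} \<or> W = fst R)"

definition rep_isomorphism ::
    "('g, 'm) monoid_scheme \<Rightarrow> ('g, 'i) rep \<Rightarrow> ('g, 'k) rep \<Rightarrow>
     (('i \<Rightarrow> complex) \<Rightarrow> ('k \<Rightarrow> complex)) \<Rightarrow> bool" where
  "rep_isomorphism G R S \<Psi> \<longleftrightarrow> linear_map_on (fst R) \<Psi> \<and> bij_betw \<Psi> (fst R) (fst S) \<and>
     (\<forall>g\<in>carrier G. \<forall>v\<in>fst R. \<Psi> (snd R g v) = snd S g (\<Psi> v))"

text \<open>
  Isomorphism classes are formed among representations on subspaces of \<open>nat \<Rightarrow> complex\<close>. This
  space contains a copy of every finite-dimensional space, and irreducible representations of
  a finite group are finite-dimensional, so no isomorphism class is lost.
\<close>

definition Irr :: "('g, 'm) monoid_scheme \<Rightarrow> ('g, nat) rep set set" where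
  "Irr G = {R. irreducible_rep G R} //
     {(R, S). irreducible_rep G R \<and> irreducible_rep G S \<and> (\<exists>\<Psi>. rep_isomorphism G R S \<Psi>)}"

definition Irr_pr ::
    "('a, 'l) monoid_scheme \<Rightarrow> ('a \<Rightarrow> 'g) \<Rightarrow> ('g, 'm) monoid_scheme \<Rightarrow> ('g, nat) rep set set" where
  "Irr_pr F \<phi> G =
     {C \<in> Irr G. \<exists>R\<in>C. \<exists>\<gamma>\<in>carrier F. \<exists>v\<in>fst R. primitive F \<gamma> \<and> v \<noteq> 0 \<and> snd R (\<phi> \<gamma>) v = v}"

definition rep_of :: "('g, nat) rep set \<Rightarrow> ('g, nat) rep" where
  "rep_of C = (SOME R. R \<in> C)"

text \<open>
  The external direct sum of \<open>(n - 1) dim V\<close> copies of every irreducible \<open>V\<close> and one copy of the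
  trivial representation, realised inside one function space: the coordinates of the vector in
  the \<open>j\<close>-th copy of \<open>C\<close> are \<open>F (Some (C, j, k))\<close> for \<open>k :: nat\<close>, and \<open>F None\<close> is the entry in the
  trivial summand. The finite support condition is what makes this a direct sum
  independently of the finiteness of \<open>Irr G\<close>.
\<close>

type_synonym 'g sum_index = "(('g, nat) rep set \<times> nat \<times> nat) option"

definition sum_component ::
    "('g sum_index \<Rightarrow> complex) \<Rightarrow> ('g, nat) rep set \<Rightarrow> nat \<Rightarrow> (nat \<Rightarrow> complex)" where
  "sum_component F C j = (\<lambda>k. F (Some (C, j, k)))"

definition gaschuetz_space ::
    "('g, 'm) monoid_scheme \<Rightarrow> nat \<Rightarrow> ('g sum_index \<Rightarrow> complex) set" where
  "gaschuetz_space G n =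
     {F. (\<forall>C j. sum_component F C j \<in>
            (if C \<in> Irr G \<and> j < (n - 1) * cfun.dim (fst (rep_of C)) then fst (rep_of C) else {0})) \<and>
         finite {C. \<exists>j. sum_component F C j \<noteq> 0}}"

definition gaschuetz_rep ::
    "('g, 'm) monoid_scheme \<Rightarrow> nat \<Rightarrow> ('g, (('g, nat) rep set \<times> nat \<times> nat) option) rep" where
  "gaschuetz_rep G n =
     (gaschuetz_space G n,
      \<lambda>g F i. case i of None \<Rightarrow> F None
        | Some (C, j, k) \<Rightarrow>
            if C \<in> Irr G then snd (rep_of C) g (sum_component F C j) k else 0)"

definition gaschuetz_subsum ::
    "('g, 'm) monoid_scheme \<Rightarrow> nat \<Rightarrow> ('g, nat) rep set set \<Rightarrow> ('g sum_index \<Rightarrow> complex) set" where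
  "gaschuetz_subsum G n S =
     {F \<in> gaschuetz_space G n. \<forall>C. C \<notin> S \<longrightarrow> (\<forall>j. sum_component F C j = 0)}"


section \<open>Homology\<close>

text \<open>
  A 1-chain is a function \<open>c\<close> on arcs with \<open>c (r a) = - c a\<close>; the oriented edge \<open>a\<close> is the chain
  with value 1 at \<open>a\<close> and -1 at \<open>r a\<close>. For such \<open>c\<close> the coefficient of the boundary at \<open>v\<close> is
  the sum of \<open>c\<close> over all arcs with head \<open>v\<close>. Graphs have no 2-cells, so \<open>H\<^sub>1\<close> is the space
  of cycles.
\<close>

definition homology1 :: "('v, 'e) pre_digraph \<Rightarrow> ('e \<Rightarrow> 'e) \<Rightarrow> ('e \<Rightarrow> complex) set" where
  "homology1 X r =
     {c. (\<forall>a. a \<notin> arcs X \<longrightarrow> c a = 0) \<and> (\<forall>a\<in>arcs X. c (r a) = - c a) \<and>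
         (\<forall>v\<in>verts X. (\<Sum>a\<in>in_arcs X v. c a) = 0)}"

definition walk_class :: "('e \<Rightarrow> 'e) \<Rightarrow> 'e list \<Rightarrow> ('e \<Rightarrow> complex)" where
  "walk_class r p = (\<lambda>a. of_nat (count_list p a) - of_nat (count_list p (r a)))"

definition homology_rep ::
    "('w, 'd) pre_digraph \<Rightarrow> ('d \<Rightarrow> 'd) \<Rightarrow> (('w \<Rightarrow> 'w) \<times> ('d \<Rightarrow> 'd), 'd) rep" where
  "homology_rep Y rY = (homology1 Y rY, \<lambda>g c. c \<circ> inv_into UNIV (snd g))"

definition primitive_homology ::
    "('w, 'd) pre_digraph \<Rightarrow> ('d \<Rightarrow> 'd) \<Rightarrow> ('v, 'e) pre_digraph \<Rightarrow> ('e \<Rightarrow> 'e) \<Rightarrow>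
     ('w \<Rightarrow> 'v) \<Rightarrow> ('d \<Rightarrow> 'e) \<Rightarrow> 'w \<Rightarrow> ('d \<Rightarrow> complex) set" where
  "primitive_homology Y rY X rX fv fe y0 =
     cfun.span {walk_class rY (map (snd g) q) | g q p.
        is_loop X (fv y0) p \<and>
        primitive (fundamental_group X rX (fv y0)) (loop_class X rX (fv y0) p) \<and>
        preferred_elevation Y fe y0 p q \<and> g \<in> carrier (deck_group Y rY fv fe)}"

end

theory Submission
  imports Defs
begin

text \<open>
  The homology class of the preferred elevation of a loop \<open>\<gamma>\<close> is fixed by the deck
  transformation \<open>\<phi> \<gamma>\<close>. Indeed the elevation is a closed lift of some power \<open>\<gamma>\<^sup>k\<close>, and
  \<open>\<phi> \<gamma>\<close> moves its starting point to the end of the lift of the first factor \<open>\<gamma>\<close>; as lifts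
  are unique, \<open>\<phi> \<gamma>\<close> merely rotates the closed walk, and rotation does not change its class
  (\<open>elevation_class_fixed\<close>).

  An equivariant isomorphism \<open>\<Psi>\<close> onto the direct sum therefore sends the class to a vector all
  of whose components are fixed by \<open>\<phi> \<gamma>\<close>. If \<open>\<gamma>\<close> is primitive, a nonzero component in a copy of
  an irreducible \<open>V\<close> is a witness that \<open>V\<close> belongs to \<open>Irr_pr\<close>; so the image lies in the
  asserted partial sum (\<open>fixed_vector_in_subsum\<close>). The partial sum is a subrepresentation, which
  takes care of the remaining elevations and of their linear span.
\<close>

section \<open>Walks and their classes\<close>

lemma (in wf_digraph) awalk_appendE:
  assumes "awalk u (p @ q) w"
  obtains v where "awalk u p v" "awalk v q w"
  using assms by auto

lemma (in wf_digraph) awalk_appendI: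
  assumes "awalk u p v" "awalk v q w"
  shows "awalk u (p @ q) w"
  using assms by (induction p arbitrary: u) (auto simp: awalk_Cons_iff awalk_Nil_iff)

lemma walk_class_append_commute: "walk_class r (p @ q) = walk_class r (q @ p)"
  by (simp add: walk_class_def add.commute)

lemma walk_class_Cons:
  "walk_class r (e # p) a =
     walk_class r p a + (if a = e then 1 else 0) - (if r a = e then 1 else 0)"
  by (auto simp: walk_class_def)

text \<open>
  Each arc of the walk contributes its head minus its tail to the boundary, and the sum
  telescopes.
\<close>

lemma walk_boundary:
  assumes "bidirected_digraph Y r" "fin_digraph Y" "pre_digraph.awalk Y u p w"
  shows "(\<Sum>a\<in>in_arcs Y v. walk_class r p a) =
           (if w = v then 1 else 0) - (if u = v then 1 else 0)"
proof -
  interpret bidirected_digraph Y r by fact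
  interpret fin_digraph Y by fact
  show ?thesis
    using assms(3)
  proof (induction p arbitrary: u)
    case Nil
    then show ?case by (simp add: awalk_Nil_iff walk_class_def)
  next
    case (Cons e p)
    then have e: "e \<in> arcs Y" "u = tail Y e" "awalk (head Y e) p w"
      by (auto simp: awalk_Cons_iff)
    have rev: "r a = e \<longleftrightarrow> a = r e" for a
      using arev_arev by metis
    have fin: "finite (in_arcs Y v)" by (rule finite_in_arcs)
    have "(\<Sum>a\<in>in_arcs Y v. walk_class r (e # p) a) =
        (\<Sum>a\<in>in_arcs Y v. walk_class r p a) + (if e \<in> in_arcs Y v then 1 else 0)
          - (if r e \<in> in_arcs Y v then 1 else 0)"
      by (simp only: walk_class_Cons rev sum.distrib sum_subtractf sum.delta[OF fin])
    then show ?case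
      using e Cons.IH[OF e(3)] by simp
  qed
qed

lemma closed_walk_class_in_homology1:
  assumes "bidirected_digraph Y r" "fin_digraph Y" "pre_digraph.awalk Y u p u"
  shows "walk_class r p \<in> homology1 Y r"
proof -
  interpret bidirected_digraph Y r by fact
  show ?thesis
    using walk_boundary[OF assms] by (auto simp: homology1_def walk_class_def arev_eq)
qed

lemma subspace_homology1: "cfun.subspace (homology1 Y r)"
  by (rule cfun.subspaceI)
    (auto simp: homology1_def cscale_def sum.distrib simp flip: sum_distrib_left)

section \<open>Lifts and deck transformations\<close>

text \<open>
  \<open>fe\<close> is injective on the star of the current vertex, so two lifts that have agreed so far
  take the same next arc.
\<close>

lemma unique_path_lifting:
  assumes "wf_digraph Y" "graph_covering Y rY X rX fv fe"
    and "pre_digraph.awalk Y u p w" "pre_digraph.awalk Y u q w'" "map fe p = map fe q"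
  shows "p = q"
proof -
  interpret wf_digraph Y by fact
  show ?thesis
    using assms(3-5)
  proof (induction p arbitrary: u q)
    case (Cons a p)
    then obtain b q' where q: "q = b # q'" "fe a = fe b" by (cases q) auto
    have "a \<in> out_arcs Y u" "b \<in> out_arcs Y u" "u \<in> verts Y"
      using Cons.prems q by (auto simp: awalk_Cons_iff)
    moreover have "inj_on fe (out_arcs Y u)"
      using assms(2) \<open>u \<in> verts Y\<close> by (auto simp: graph_covering_def bij_betw_def)
    ultimately have "a = b" using q(2) by (auto dest: inj_onD)
    then show ?case using Cons q by (auto simp: awalk_Cons_iff)
  qed simp
qed

lemma deck_transformation_awalk:
  assumes "wf_digraph Y" "g \<in> carrier (deck_group Y rY fv fe)" "pre_digraph.awalk Y u p w"
  shows "pre_digraph.awalk Y (fst g u) (map (snd g) p) (fst g w)"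
proof -
  interpret wf_digraph Y by fact
  have "fst g permutes verts Y" "snd g permutes arcs Y"
    "\<forall>a\<in>arcs Y. tail Y (snd g a) = fst g (tail Y a) \<and> head Y (snd g a) = fst g (head Y a)"
    using assms(2) by (auto simp: deck_group_def)
  then show ?thesis
    using assms(3)
    by (induction p arbitrary: u) (auto simp: awalk_Cons_iff awalk_Nil_iff permutes_in_image)
qed

lemma homology_rep_walk_class:
  assumes "bidirected_digraph Y rY" "g \<in> carrier (deck_group Y rY fv fe)"
  shows "snd (homology_rep Y rY) g (walk_class rY p) = walk_class rY (map (snd g) p)"
proof -
  interpret bidirected_digraph Y rY by fact
  have perm: "snd g permutes arcs Y" and "\<forall>a\<in>arcs Y. snd g (rY a) = rY (snd g a)"
    using assms(2) by (auto simp: deck_group_def)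
  \<comment> \<open>Off the arc set both maps are the identity, so they commute everywhere.\<close>
  then have comm: "snd g (rY a) = rY (snd g a)" for a
    by (cases "a \<in> arcs Y") (auto simp: arev_eq permutes_not_in)
  have inj: "inj (snd g)" using perm by (rule permutes_inj)
  have "walk_class rY p (inv_into UNIV (snd g) a) = walk_class rY (map (snd g) p) a" for a
  proof -
    obtain b where a: "a = snd g b" using permutes_surj[OF perm] by blast
    show ?thesis
      unfolding a by (simp add: walk_class_def inj count_list_map_conv flip: comm)
  qed
  then show ?thesis by (simp add: homology_rep_def fun_eq_iff)
qed

lemma concat_replicate_rotate: "concat (replicate k p) @ p = p @ concat (replicate k p)"
  by (induction k) auto

text \<open>
  Write the elevation as \<open>q1 @ q2\<close> with \<open>q1\<close> the lift of the first factor \<open>p\<close>. Its translate by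
  \<open>\<phi> [p]\<close> and its rotation \<open>q2 @ q1\<close> both start at the end of \<open>q1\<close> and both lie over the same
  power of \<open>p\<close>, so they are the same walk.
\<close>

lemma elevation_class_fixed:
  assumes "bidirected_digraph Y rY" "graph_covering Y rY X rX fv fe"
    and "defines_covering Y rY X rX fv fe y0 \<phi>"
    and "is_loop X (fv y0) p" "preferred_elevation Y fe y0 p q"
    and g: "\<phi> (loop_class X rX (fv y0) p) \<in> carrier (deck_group Y rY fv fe)"
  shows "snd (homology_rep Y rY) (\<phi> (loop_class X rX (fv y0) p)) (walk_class rY q)
           = walk_class rY q"
proof -
  interpret bidirected_digraph Y rY by fact
  have wf: "wf_digraph Y" ..
  define h where "h = \<phi> (loop_class X rX (fv y0) p)"
  obtain k where k: "k \<ge> 1" and q: "awalk y0 q y0" "map fe q = concat (replicate k p)"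
    using assms(5) by (auto simp: preferred_elevation_def is_loop_def)
  from k obtain m where m: "k = Suc m" by (cases k) auto
  from q(2)[unfolded m] obtain q1 q2
    where q12: "q = q1 @ q2" "map fe q1 = p" "map fe q2 = concat (replicate m p)"
    by (auto simp: map_eq_append_conv)
  obtain z where z: "awalk y0 q1 z" "awalk z q2 y0"
    using q(1) unfolding q12(1) by (rule awalk_appendE)
  \<comment> \<open>This is how \<open>\<phi>\<close> and the covering correspond: \<open>\<phi> [p]\<close> moves \<open>y0\<close> to the end of \<open>q1\<close>.\<close>
  have "fst h y0 = z"
    using assms(3,4) z(1) q12(2) unfolding defines_covering_def h_def by blast
  then have moved: "awalk z (map (snd h) q) z"
    using deck_transformation_awalk[OF wf g q(1)] by (simp add: h_def)
  have "set q \<subseteq> arcs Y" using q(1) by auto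
  then have "map fe (map (snd h) q) = map fe q"
    using g by (auto simp: deck_group_def h_def)
  also have "\<dots> = map fe (q2 @ q1)"
    using q12 by (simp add: concat_replicate_rotate)
  finally have "map (snd h) q = q2 @ q1"
    using unique_path_lifting[OF wf assms(2) moved awalk_appendI[OF z(2,1)]] by blast
  then show ?thesis
    using homology_rep_walk_class[OF assms(1) g, of q] q12(1)
    by (simp add: h_def walk_class_append_commute)
qed

section \<open>The partial sums of the direct sum\<close>

lemma rep_of_in_class:
  assumes "C \<in> Irr G"
  shows "rep_of C \<in> C"
proof -
  have "rep_isomorphism G R R id" for R :: "('a, nat) rep"
    by (simp add: rep_isomorphism_def linear_map_on_def)
  then have "C \<noteq> {}" using assms by (auto simp: Irr_def quotient_def)
  then show ?thesis unfolding rep_of_def by (simp add: some_in_eq)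
qed

lemma irreducible_rep_of:
  assumes "C \<in> Irr G"
  shows "irreducible_rep G (rep_of C)"
  using rep_of_in_class[OF assms] assms by (auto simp: Irr_def quotient_def)

lemma representation_zero:
  assumes "representation G R" "g \<in> carrier G"
  shows "snd R g 0 = 0"
proof -
  have "snd R g (cscale 0 0) = cscale 0 (snd R g 0)"
    using assms unfolding representation_def linear_map_on_def cfun.subspace_def by blast
  then show ?thesis by simp
qed

lemma sum_component_action:
  assumes "C \<in> Irr G"
  shows "sum_component (snd (gaschuetz_rep G n) g F) C j = snd (rep_of C) g (sum_component F C j)"
  using assms by (simp add: gaschuetz_rep_def sum_component_def)

lemma sum_component_add: "sum_component (F + F') C j = sum_component F C j + sum_component F' C j"
  by (simp add: sum_component_def fun_eq_iff)

lemma sum_component_cscale: "sum_component (cscale c F) C j = cscale c (sum_component F C j)"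
  by (simp add: sum_component_def cscale_def)

lemma sum_component_cases:
  assumes "F \<in> gaschuetz_space G n" "sum_component F C j \<noteq> 0"
  shows "C \<in> Irr G" "sum_component F C j \<in> fst (rep_of C)"
proof -
  have "sum_component F C j \<in>
      (if C \<in> Irr G \<and> j < (n - 1) * cfun.dim (fst (rep_of C)) then fst (rep_of C) else {0})"
    using assms(1) by (auto simp: gaschuetz_space_def)
  then show "C \<in> Irr G" "sum_component F C j \<in> fst (rep_of C)"
    using assms(2) by (auto split: if_splits)
qed

text \<open>
  The action is componentwise, so a nonzero component of a fixed vector is a nonzero fixed
  vector of the representation \<open>rep_of C\<close>, which is what \<open>Irr_pr\<close> asks of the class \<open>C\<close>.
\<close>

lemma fixed_vector_in_subsum:
  assumes "F \<in> gaschuetz_space G n" "snd (gaschuetz_rep G n) (\<phi> \<gamma>) F = F"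
    and "primitive P \<gamma>"
  shows "F \<in> gaschuetz_subsum G n (Irr_pr P \<phi> G)"
proof -
  have "C \<in> Irr_pr P \<phi> G" if nz: "sum_component F C j \<noteq> 0" for C j
  proof -
    note C = sum_component_cases[OF assms(1) nz]
    have "snd (rep_of C) (\<phi> \<gamma>) (sum_component F C j) = sum_component F C j"
      using sum_component_action[OF C(1), of n "\<phi> \<gamma>" F j] assms(2) by simp
    moreover have "\<gamma> \<in> carrier P" using assms(3) by (auto simp: primitive_def free_basis_def)
    ultimately show ?thesis
      using C nz assms(3) rep_of_in_class[OF C(1)] unfolding Irr_pr_def by blast
  qed
  then show ?thesis using assms(1) by (auto simp: gaschuetz_subsum_def)
qed

text \<open>
  That the translate lies in the full direct sum is a hypothesis; for vectors in the image of
  an equivariant map it is immediate, as the translate is again in the image.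
\<close>

lemma gaschuetz_subsum_invariant:
  assumes "F \<in> gaschuetz_subsum G n S" "g \<in> carrier G"
    and space: "snd (gaschuetz_rep G n) g F \<in> gaschuetz_space G n"
  shows "snd (gaschuetz_rep G n) g F \<in> gaschuetz_subsum G n S"
proof -
  have "sum_component (snd (gaschuetz_rep G n) g F) C j = 0" if "C \<notin> S" for C j
  proof (cases "C \<in> Irr G")
    case True
    have "representation G (rep_of C)"
      using irreducible_rep_of[OF True] by (simp add: irreducible_rep_def)
    moreover have "sum_component F C j = 0"
      using assms(1) that by (auto simp: gaschuetz_subsum_def)
    ultimately show ?thesis
      using representation_zero assms(2) by (simp add: sum_component_action[OF True])
  next
    case False
    then show ?thesis using sum_component_cases(1)[OF space] by blast
  qed
  then show ?thesis using space by (auto simp: gaschuetz_subsum_def)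
qed

lemma subspace_preimage_subsum:
  assumes "cfun.subspace V" "linear_map_on V \<Psi>" "\<Psi> ` V \<subseteq> gaschuetz_space G n"
  shows "cfun.subspace {c \<in> V. \<Psi> c \<in> gaschuetz_subsum G n S}"
proof (rule cfun.subspaceI)
  have lin: "\<Psi> (v + w) = \<Psi> v + \<Psi> w" "\<Psi> (cscale c v) = cscale c (\<Psi> v)"
    if "v \<in> V" "w \<in> V" for v w c
    using assms(2) that by (auto simp: linear_map_on_def)
  have in_V: "0 \<in> V" "v + w \<in> V" "cscale c v \<in> V" if "v \<in> V" "w \<in> V" for v w c
    using assms(1) that by (auto simp: cfun.subspace_def)
  have zero: "0 \<in> V" using assms(1) by (simp add: cfun.subspace_def)
  then have "\<Psi> 0 = 0" using lin(2)[OF zero zero, of 0] by simp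
  then show "0 \<in> {c \<in> V. \<Psi> c \<in> gaschuetz_subsum G n S}"
    using zero assms(3) by (force simp: gaschuetz_subsum_def sum_component_def fun_eq_iff)
  fix v w c
  assume v: "v \<in> {c \<in> V. \<Psi> c \<in> gaschuetz_subsum G n S}"
  then have "\<Psi> (cscale c v) \<in> gaschuetz_space G n" using in_V(3) assms(3) by blast
  then show "cscale c v \<in> {c \<in> V. \<Psi> c \<in> gaschuetz_subsum G n S}"
    using v in_V(3) by (auto simp: gaschuetz_subsum_def lin sum_component_cscale)
  assume w: "w \<in> {c \<in> V. \<Psi> c \<in> gaschuetz_subsum G n S}"
  have "\<Psi> (v + w) \<in> gaschuetz_space G n" using v w in_V(2) assms(3) by blast
  then show "v + w \<in> {c \<in> V. \<Psi> c \<in> gaschuetz_subsum G n S}"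
    using v w in_V(2) by (auto simp: gaschuetz_subsum_def lin sum_component_add)
qed

section \<open>Primitive homology\<close>

theorem theorem1p4:
  fixes X :: "('v, 'e) pre_digraph" and rX :: "'e \<Rightarrow> 'e"
    and Y :: "('w, 'd) pre_digraph" and rY :: "'d \<Rightarrow> 'd"
    and fv :: "'w \<Rightarrow> 'v" and fe :: "'d \<Rightarrow> 'e"
    and x0 :: 'v and y0 :: 'w and n :: nat
    and \<phi> :: "'e list set \<Rightarrow> ('w \<Rightarrow> 'w) \<times> ('d \<Rightarrow> 'd)"
    and \<Psi> :: "('d \<Rightarrow> complex) \<Rightarrow> ((('w \<Rightarrow> 'w) \<times> ('d \<Rightarrow> 'd)) sum_index \<Rightarrow> complex)"
  defines "F \<equiv> fundamental_group X rX x0"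
    and "G \<equiv> deck_group Y rY fv fe"
  assumes "finite_connected_graph X rX"
    and "finite_connected_graph Y rY"
    and "normal_covering Y rY X rX fv fe"
    and "finite (carrier G)"
    and "y0 \<in> verts Y" and "fv y0 = x0"
    and "free_of_rank n F" and "n \<ge> 2"
    and "defines_covering Y rY X rX fv fe y0 \<phi>"
    and "rep_isomorphism G (homology_rep Y rY) (gaschuetz_rep G n) \<Psi>"
  shows "\<Psi> ` primitive_homology Y rY X rX fv fe y0 \<subseteq> gaschuetz_subsum G n (Irr_pr F \<phi> G)"
proof -
  have bi: "bidirected_digraph Y rY" and fin: "fin_digraph Y"
    using assms(4) by (auto simp: finite_connected_graph_def)
  interpret bidirected_digraph Y rY by fact
  have cov: "graph_covering Y rY X rX fv fe"
    using assms(5) by (simp add: normal_covering_def)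
  have lin: "linear_map_on (homology1 Y rY) \<Psi>"
    and into: "\<Psi> ` homology1 Y rY \<subseteq> gaschuetz_space G n"
    and equiv: "\<And>g c. g \<in> carrier G \<Longrightarrow> c \<in> homology1 Y rY \<Longrightarrow>
      \<Psi> (snd (homology_rep Y rY) g c) = snd (gaschuetz_rep G n) g (\<Psi> c)"
    using assms(12)
    by (auto simp: rep_isomorphism_def homology_rep_def gaschuetz_rep_def bij_betw_def)
  let ?S = "{c \<in> homology1 Y rY. \<Psi> c \<in> gaschuetz_subsum G n (Irr_pr F \<phi> G)}"
  \<comment> \<open>The preferred elevation has a fixed class; its translates follow by invariance of the sum.\<close>
  have elevation: "walk_class rY (map (snd g) q) \<in> ?S"
    if p: "is_loop X x0 p" and prim: "primitive F (loop_class X rX x0 p)"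
      and q: "preferred_elevation Y fe y0 p q" and g: "g \<in> carrier G" for g q p
  proof -
    let ?h = "\<phi> (loop_class X rX x0 p)"
    have "loop_class X rX x0 p \<in> carrier F"
      using prim by (auto simp: primitive_def free_basis_def)
    then have h: "?h \<in> carrier G"
      using assms(11) \<open>fv y0 = x0\<close> by (auto simp: defines_covering_def epi_def F_def G_def)
    have loop: "awalk y0 q y0" using q by (auto simp: preferred_elevation_def is_loop_def)
    have q_cyc: "walk_class rY q \<in> homology1 Y rY"
      by (rule closed_walk_class_in_homology1[OF bi fin loop])
    have gq: "snd (homology_rep Y rY) g (walk_class rY q) = walk_class rY (map (snd g) q)"
      using g unfolding G_def by (rule homology_rep_walk_class[OF bi])
    have gq_cyc: "walk_class rY (map (snd g) q) \<in> homology1 Y rY"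
      using deck_transformation_awalk[OF wf_digraph_axioms g[unfolded G_def] loop]
      by (rule closed_walk_class_in_homology1[OF bi fin])
    have "snd (homology_rep Y rY) ?h (walk_class rY q) = walk_class rY q"
      using elevation_class_fixed[OF bi cov assms(11) _ q] p h \<open>fv y0 = x0\<close>
      by (simp add: G_def)
    then have "snd (gaschuetz_rep G n) ?h (\<Psi> (walk_class rY q)) = \<Psi> (walk_class rY q)"
      using equiv[OF h q_cyc] by simp
    then have sub: "\<Psi> (walk_class rY q) \<in> gaschuetz_subsum G n (Irr_pr F \<phi> G)"
      using into q_cyc prim by (intro fixed_vector_in_subsum) auto
    have "\<Psi> (walk_class rY (map (snd g) q)) = snd (gaschuetz_rep G n) g (\<Psi> (walk_class rY q))"
      using equiv[OF g q_cyc] gq by simp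
    then have "\<Psi> (walk_class rY (map (snd g) q)) \<in> gaschuetz_subsum G n (Irr_pr F \<phi> G)"
      using gaschuetz_subsum_invariant[OF sub g] into gq_cyc by auto
    then show ?thesis using gq_cyc by simp
  qed
  have "primitive_homology Y rY X rX fv fe y0 \<subseteq> ?S"
    unfolding primitive_homology_def
    using elevation \<open>fv y0 = x0\<close>
    by (intro cfun.span_minimal subspace_preimage_subsum[OF subspace_homology1 lin into])
      (auto simp: F_def G_def)
  then show ?thesis by auto
qed

end
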